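(* There exist a convex polygon $P$ in the plane and a triangulation $\psi:|T|\to P$ of $P$ such that the space $X(T,\psi)$, consisting of all strictly Delaunay triangulations of $P$ that are isotopic to $\psi$ and agree with $\psi$ on the boundary vertices of $T$, is not connected.
   Context: $T$ is a finite 2-dimensional simplicial complex whose underlying space $|T|$ is homeomorphic to a closed disk. A convex polygon $P\subset\mathbb R^2$ is determined by a sequence of cyclically ordered vertices. A triangulation of $P$ is a homeomorphism $\varphi:|T|\to P$ which is linear on each triangle of $T$; it is determined by the images of the vertices, and $X(T,\psi)$ is topologized as a subspace of $(\mathbb R^2)^V$, $V$ being the vertex set of $T$. The positions of the boundary vertices are the same for all elements of $X(T,\psi)$. A triangulation is strictly Delaunay if for any pair of adjacent triangles $\triangle ABC$, $\triangle ABD$ in it, $D$ is strictly outside the circumcircle of $\triangle ABC$; equivalently $a+a'<\pi$ for each interior edge, where $a,a'$ are the two angles opposite to that edge. *)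

theory Defs
  imports "HOL-Analysis.Analysis"
begin

definition convex_polygon :: "(real^2) set \<Rightarrow> bool"
  where "convex_polygon P \<longleftrightarrow> polytope P \<and> aff_dim P = 2"

text \<open>Simplicial complexes are the finite geometric ones of \<^theory>\<open>HOL-Analysis.Polytope\<close>; the
  underlying space of \<^term>\<open>T\<close> is \<^term>\<open>\<Union>T\<close>. (The library's face closure puts the
  empty simplex in every nonempty complex; it plays no role below.)\<close>

definition disk_complex :: "'a::euclidean_space set set \<Rightarrow> bool"
  where "disk_complex T \<longleftrightarrow>
    simplicial_complex T \<and>
    (\<forall>S\<in>T. aff_dim S \<le> 2) \<and> (\<exists>S\<in>T. aff_dim S = 2) \<and>
    \<Union>T homeomorphic cball (0::real^2) 1"

definition complex_vertices :: "'a::euclidean_space set set \<Rightarrow> 'a set"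
  where "complex_vertices T = {v. {v} \<in> T}"

definition complex_triangles :: "'a::euclidean_space set set \<Rightarrow> 'a set set"
  where "complex_triangles T = {S \<in> T. 2 simplex S}"

text \<open>For a triangulated disk, the boundary edges are those lying in only one triangle.\<close>

definition boundary_edges :: "'a::euclidean_space set set \<Rightarrow> 'a set set"
  where "boundary_edges T = {e \<in> T. 1 simplex e \<and> (\<exists>!S. S \<in> complex_triangles T \<and> e \<subseteq> S)}"

definition boundary_vertices :: "'a::euclidean_space set set \<Rightarrow> 'a set"
  where "boundary_vertices T = {v \<in> complex_vertices T. \<exists>e\<in>boundary_edges T. v \<in> e}"

definition polygon_triangulation ::
    "'a::euclidean_space set set \<Rightarrow> (real^2) set \<Rightarrow> ('a \<Rightarrow> real^2) \<Rightarrow> bool"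
  where "polygon_triangulation T P \<phi> \<longleftrightarrow>
    (\<exists>\<phi>'. homeomorphism (\<Union>T) P \<phi> \<phi>') \<and>
    (\<forall>S\<in>complex_triangles T. \<exists>L b. linear L \<and> (\<forall>x\<in>S. \<phi> x = L x + b))"

text \<open>The sphere through the three image points is unique (and exists) as soon as
  \<^term>\<open>\<phi>\<close> is injective and affine on the triangle \<^term>\<open>convex hull {A, B, C}\<close>.\<close>

definition strictly_Delaunay :: "'a::euclidean_space set set \<Rightarrow> ('a \<Rightarrow> real^2) \<Rightarrow> bool"
  where "strictly_Delaunay T \<phi> \<longleftrightarrow>
    (\<forall>A B C D. convex hull {A, B, C} \<in> complex_triangles T \<and>
               convex hull {A, B, D} \<in> complex_triangles T \<and>
               convex hull {A, B, C} \<noteq> convex hull {A, B, D} \<longrightarrow>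
      (\<exists>z r. {\<phi> A, \<phi> B, \<phi> C} \<subseteq> sphere z r \<and> \<phi> D \<notin> cball z r))"

text \<open>Isotopy: a homotopy through homeomorphisms of the underlying space onto \<^term>\<open>P\<close>;
  the intermediate maps need neither be linear on triangles nor fix the boundary.\<close>

definition isotopic_triangulations ::
    "'a::euclidean_space set set \<Rightarrow> (real^2) set \<Rightarrow> ('a \<Rightarrow> real^2) \<Rightarrow> ('a \<Rightarrow> real^2) \<Rightarrow> bool"
  where "isotopic_triangulations T P \<psi> \<phi> \<longleftrightarrow>
    homotopic_with (\<lambda>f. \<exists>g. homeomorphism (\<Union>T) P f g)
      (top_of_set (\<Union>T)) (top_of_set P) \<psi> \<phi>"

text \<open>A triangulation is recorded by the images of the vertices, as a point of the product
  of copies of the plane indexed by the vertex set (extensional functions).\<close>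

definition Delaunay_configurations ::
    "'a::euclidean_space set set \<Rightarrow> (real^2) set \<Rightarrow> ('a \<Rightarrow> real^2) \<Rightarrow> ('a \<Rightarrow> real^2) set"
  where "Delaunay_configurations T P \<psi> =
    {restrict \<phi> (complex_vertices T) | \<phi>.
       polygon_triangulation T P \<phi> \<and> strictly_Delaunay T \<phi> \<and>
       isotopic_triangulations T P \<psi> \<phi> \<and>
       (\<forall>v\<in>boundary_vertices T. \<phi> v = \<psi> v)}"

definition Delaunay_space ::
    "'a::euclidean_space set set \<Rightarrow> (real^2) set \<Rightarrow> ('a \<Rightarrow> real^2) \<Rightarrow> ('a \<Rightarrow> real^2) topology"
  where "Delaunay_space T P \<psi> =
    subtopology (product_topology (\<lambda>_. euclidean) (complex_vertices T))
      (Delaunay_configurations T P \<psi>)"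

end

(*
  The hexagon with vertices (2,1), (2,-1), (-2,1), (-2,-1), (0,5), (0,-5) is cut into the top and
  bottom triangles outside the rectangle |x| <= 2, |y| <= 1, and the rectangle is coned from a single
  interior vertex p.  The circumcircles of the top and bottom triangles (centres (0,5/2) and
  (0,-5/2), radius 5/2) touch at the origin, and the Delaunay condition at the long sides of the
  rectangle keeps p outside both closed disks.  Together these disks contain every point of the
  hexagon on the y-axis, so p is either to the left or to the right of this axis.  Both sides occur:
  p = (1,0) and p = (-1,0) are reached by sliding p horizontally from the origin, which is an isotopy
  (through triangulations that are not all Delaunay).
*)
theory Submission
  imports Defs
begin

section \<open>Geometric complexes from hat functions\<close>

text \<open>The function \<open>lam v\<close> is a globally defined piecewise linear extension of the barycentric
  coordinate of \<open>v\<close>. Its consistency across the facets is what makes the facets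
  affinely independent and lets their hulls meet only in hulls of common vertices.\<close>

locale hat_functions =
  fixes F :: "'a::euclidean_space set set" and lam :: "'a \<Rightarrow> 'a \<Rightarrow> real"
  assumes finite_facets: "finite F" and finite_facet: "\<sigma> \<in> F \<Longrightarrow> finite \<sigma>"
    and hat_facet: "\<lbrakk>\<sigma> \<in> F; v \<in> \<Union>F; \<And>w. w \<in> \<sigma> \<Longrightarrow> 0 \<le> c w; sum c \<sigma> = 1\<rbrakk>
      \<Longrightarrow> lam v (\<Sum>w\<in>\<sigma>. c w *\<^sub>R w) = (if v \<in> \<sigma> then c v else 0)"
begin

definition faces :: "'a set set"
  where "faces = {\<sigma>. \<exists>M\<in>F. \<sigma> \<subseteq> M}"

definition realization :: "'a set set"
  where "realization = (\<lambda>\<sigma>. convex hull \<sigma>) ` faces"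

lemma facet_in_faces: "M \<in> F \<Longrightarrow> M \<in> faces"
  by (auto simp: faces_def)

lemma face_subset: "\<sigma> \<in> faces \<Longrightarrow> \<sigma>' \<subseteq> \<sigma> \<Longrightarrow> \<sigma>' \<in> faces"
  by (auto simp: faces_def)

lemma finite_face: "\<sigma> \<in> faces \<Longrightarrow> finite \<sigma>"
  unfolding faces_def using finite_facet finite_subset by blast

lemma face_vertices: "\<sigma> \<in> faces \<Longrightarrow> \<sigma> \<subseteq> \<Union>F"
  by (auto simp: faces_def)

text \<open>Extending the weights by zero to a facet containing \<open>\<sigma>\<close> changes
  neither their sum nor the point.\<close>

lemma hat_face:
  assumes "\<sigma> \<in> faces" "v \<in> \<Union>F" "\<And>w. w \<in> \<sigma> \<Longrightarrow> 0 \<le> c w" "sum c \<sigma> = 1"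
  shows "lam v (\<Sum>w\<in>\<sigma>. c w *\<^sub>R w) = (if v \<in> \<sigma> then c v else 0)"
proof -
  obtain M where M: "M \<in> F" "\<sigma> \<subseteq> M" using assms(1) by (auto simp: faces_def)
  define d where "d w = (if w \<in> \<sigma> then c w else 0)" for w
  have fM: "finite M" using M finite_facet by auto
  have "sum d M = sum c \<sigma>" unfolding d_def
    using M fM by (simp add: sum.If_cases Int_absorb1)
  moreover have "(\<Sum>w\<in>M. d w *\<^sub>R w) = (\<Sum>w\<in>\<sigma>. c w *\<^sub>R w)"
    by (rule sum.mono_neutral_cong_right) (use M fM in \<open>auto simp: d_def\<close>)
  moreover have "\<And>w. 0 \<le> d w" by (simp add: d_def assms(3))
  ultimately have "lam v (\<Sum>w\<in>\<sigma>. c w *\<^sub>R w) = (if v \<in> M then d v else 0)"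
    using hat_facet[of M v d] M assms by auto
  then show ?thesis using M by (auto simp: d_def)
qed

text \<open>The hat functions act as barycentric coordinates on every face, yet depend on the point
  alone. This allows different faces to be compared at a common point.\<close>

lemma hull_face:
  assumes "\<sigma> \<in> faces" "x \<in> convex hull \<sigma>"
  shows "\<And>v. v \<in> \<sigma> \<Longrightarrow> 0 \<le> lam v x" "(\<Sum>v\<in>\<sigma>. lam v x) = 1"
    "(\<Sum>v\<in>\<sigma>. lam v x *\<^sub>R v) = x" "\<And>v. v \<in> \<Union>F \<Longrightarrow> v \<notin> \<sigma> \<Longrightarrow> lam v x = 0"
proof -
  obtain c where c: "\<forall>v\<in>\<sigma>. 0 \<le> c v" "sum c \<sigma> = 1" "(\<Sum>v\<in>\<sigma>. c v *\<^sub>R v) = x"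
    using assms(2) unfolding convex_hull_finite[OF finite_face[OF assms(1)]] by auto
  have l: "lam v x = (if v \<in> \<sigma> then c v else 0)" if "v \<in> \<Union>F" for v
    using hat_face[OF assms(1) that] c by auto
  have l': "lam v x = c v" if "v \<in> \<sigma>" for v
    using l[of v] face_vertices[OF assms(1)] that by auto
  show "\<And>v. v \<in> \<sigma> \<Longrightarrow> 0 \<le> lam v x" "(\<Sum>v\<in>\<sigma>. lam v x) = 1"
    "(\<Sum>v\<in>\<sigma>. lam v x *\<^sub>R v) = x" "\<And>v. v \<in> \<Union>F \<Longrightarrow> v \<notin> \<sigma> \<Longrightarrow> lam v x = 0"
    using l l' c by simp_all
qed

text \<open>A dependence \<open>u\<close> gives the barycentre a second system of convex weights,
  and the hat function of a vertex with \<open>u v \<noteq> 0\<close> cannot take both prescribed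
  values there.\<close>

lemma independent_facet:
  assumes "M \<in> F"
  shows "\<not> affine_dependent M"
proof
  assume dep: "affine_dependent M"
  have fM: "finite M" using assms finite_facet by auto
  obtain u v where u: "sum u M = 0" "v \<in> M" "u v \<noteq> 0" "(\<Sum>w\<in>M. u w *\<^sub>R w) = 0"
    using dep unfolding affine_dependent_explicit_finite[OF fM] by auto
  define n where "n = real (card M)"
  have n: "n > 0" using u fM by (auto simp: n_def card_gt_0_iff)
  define b where "b = (\<Sum>w\<in>M. \<bar>u w\<bar>)"
  have b: "\<bar>u w\<bar> \<le> b" if "w \<in> M" for w
    unfolding b_def using fM that by (auto intro: member_le_sum)
  have "b > 0" using b[of v] u by auto
  \<comment> \<open>Since \<open>b\<close> bounds every \<open>\<bar>u w\<bar>\<close>, the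
    perturbation of \<open>1/n\<close> never exceeds \<open>1/n\<close> in size. As \<open>u\<close>
    sums to zero and annihilates the vertices, total weight and point are unchanged.\<close>
  define c where "c w = 1/n + u w / (n * b)" for w
  have c0: "0 \<le> c w" if "w \<in> M" for w
  proof -
    have "0 \<le> (b + u w) / (n * b)" using b[OF that] n \<open>b > 0\<close> by auto
    then show ?thesis using n \<open>b > 0\<close> by (simp add: c_def field_simps)
  qed
  have c1: "sum c M = 1" using u n by (simp add: c_def sum.distrib flip: sum_divide_distrib n_def)
  have e: "(\<Sum>w\<in>M. c w *\<^sub>R w) = (\<Sum>w\<in>M. (1/n) *\<^sub>R w)"
  proof -
    have "(\<Sum>w\<in>M. c w *\<^sub>R w) = (\<Sum>w\<in>M. (1/n) *\<^sub>R w) + (1/(n*b)) *\<^sub>R (\<Sum>w\<in>M. u w *\<^sub>R w)"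
      by (simp add: c_def scaleR_add_left sum.distrib scaleR_sum_right divide_inverse mult.commute)
    then show ?thesis using u by simp
  qed
  have "v \<in> \<Union>F" using u assms by auto
  from hat_facet[OF assms this, of c] hat_facet[OF assms this, of "\<lambda>_. 1/n"]
  have "c v = 1/n" using c0 c1 e u n by (simp add: n_def)
  then show False using u n \<open>b > 0\<close> by (simp add: c_def)
qed

lemma independent_face: "\<sigma> \<in> faces \<Longrightarrow> \<not> affine_dependent \<sigma>"
  unfolding faces_def using independent_facet affine_dependent_subset by blast

text \<open>At a common point, the coordinates of vertices of \<open>\<sigma>\<close> outside
  \<open>\<tau>\<close> vanish when read off in \<open>\<tau>\<close>, so the convex combination
  over \<open>\<sigma>\<close> already lives on the intersection.\<close>

lemma hull_Int:
  assumes "\<sigma> \<in> faces" "\<tau> \<in> faces"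
  shows "convex hull \<sigma> \<inter> convex hull \<tau> = convex hull (\<sigma> \<inter> \<tau>)"
proof
  show "convex hull (\<sigma> \<inter> \<tau>) \<subseteq> convex hull \<sigma> \<inter> convex hull \<tau>"
    by (simp add: hull_mono)
  show "convex hull \<sigma> \<inter> convex hull \<tau> \<subseteq> convex hull (\<sigma> \<inter> \<tau>)"
  proof
    fix x assume x: "x \<in> convex hull \<sigma> \<inter> convex hull \<tau>"
    then have 0: "lam v x = 0" if "v \<in> \<sigma> - \<sigma> \<inter> \<tau>" for v
      using hull_face(4)[OF assms(2), of x v] that face_vertices[OF assms(1)] by blast
    have fin: "finite \<sigma>" "finite (\<sigma> \<inter> \<tau>)" using finite_face assms by auto
    have *: "\<forall>v\<in>\<sigma>. 0 \<le> lam v x" "(\<Sum>v\<in>\<sigma>. lam v x) = 1" "(\<Sum>v\<in>\<sigma>. lam v x *\<^sub>R v) = x"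
      using x hull_face[OF assms(1), of x] by simp_all
    have "(\<Sum>v\<in>\<sigma> \<inter> \<tau>. lam v x) = (\<Sum>v\<in>\<sigma>. lam v x)"
      by (rule sum.mono_neutral_left) (use 0 fin in auto)
    moreover have "(\<Sum>v\<in>\<sigma> \<inter> \<tau>. lam v x *\<^sub>R v) = (\<Sum>v\<in>\<sigma>. lam v x *\<^sub>R v)"
      by (rule sum.mono_neutral_left) (use 0 fin in auto)
    ultimately show "x \<in> convex hull (\<sigma> \<inter> \<tau>)"
      using * unfolding convex_hull_finite[OF fin(2)] by (auto intro!: exI[of _ "\<lambda>v. lam v x"])
  qed
qed

lemma vertex_in_hull_iff:
  assumes "\<sigma> \<in> faces" "v \<in> \<Union>F"
  shows "v \<in> convex hull \<sigma> \<longleftrightarrow> v \<in> \<sigma>"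
proof
  assume v: "v \<in> convex hull \<sigma>"
  have "{v} \<in> faces" using assms(2) by (auto simp: faces_def)
  then have "v \<in> convex hull (\<sigma> \<inter> {v})"
    using hull_Int[OF assms(1), of "{v}"] v by auto
  then show "v \<in> \<sigma>" by (cases "v \<in> \<sigma>") auto
qed (simp add: hull_inc)

lemma hull_subset_iff:
  assumes "\<sigma> \<in> faces" "\<tau> \<in> faces"
  shows "convex hull \<sigma> \<subseteq> convex hull \<tau> \<longleftrightarrow> \<sigma> \<subseteq> \<tau>"
  using vertex_in_hull_iff[OF assms(2)] face_vertices[OF assms(1)]
  by (meson hull_inc hull_mono subset_iff)

lemma hull_eq_iff:
  assumes "\<sigma> \<in> faces" "\<tau> \<in> faces"
  shows "convex hull \<sigma> = convex hull \<tau> \<longleftrightarrow> \<sigma> = \<tau>"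
  using hull_subset_iff[OF assms] hull_subset_iff[OF assms(2,1)] by auto

lemma simplex_face: "\<sigma> \<in> faces \<Longrightarrow> (int (card \<sigma>) - 1) simplex (convex hull \<sigma>)"
  using independent_face by (intro simplex_convex_hull) auto

lemma simplex_face_iff:
  assumes "\<sigma> \<in> faces"
  shows "n simplex (convex hull \<sigma>) \<longleftrightarrow> int (card \<sigma>) = n + 1"
proof
  assume "n simplex (convex hull \<sigma>)"
  then have "n = int (card \<sigma>) - 1"
    using aff_dim_simplex[OF simplex_face[OF assms]] aff_dim_simplex by metis
  then show "int (card \<sigma>) = n + 1" by simp
qed (use simplex_face[OF assms] in simp)

lemma simplicial_complex_realization: "simplicial_complex realization"
  unfolding simplicial_complex_def
proof (intro conjI ballI allI impI)
  have "faces \<subseteq> Pow (\<Union>F)" "finite (\<Union>F)"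
    using face_vertices finite_facets finite_facet by auto
  then show "finite realization"
    unfolding realization_def by (meson finite_Pow_iff finite_imageI finite_subset)
  show "\<exists>n. n simplex S" if "S \<in> realization" for S
    using that simplex_face unfolding realization_def by auto
  show "G \<in> realization" if "S \<in> realization \<and> G face_of S" for G S
  proof -
    from that obtain \<sigma> where s: "\<sigma> \<in> faces" "S = convex hull \<sigma>" by (auto simp: realization_def)
    with that obtain \<tau> where "\<tau> \<subseteq> \<sigma>" "G = convex hull \<tau>"
      using face_of_convex_hull_affine_independent[OF independent_face] by metis
    then show ?thesis using s face_subset by (auto simp: realization_def)
  qed
  show "(S \<inter> S') face_of S" if "S \<in> realization \<and> S' \<in> realization" for S S'
  proof -
    from that obtain \<sigma> \<tau> where s: "\<sigma> \<in> faces" "S = convex hull \<sigma>" "\<tau> \<in> faces" "S' = convex hull \<tau>"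
      by (auto simp: realization_def)
    then have "S \<inter> S' = convex hull (\<sigma> \<inter> \<tau>)" using hull_Int by auto
    then show ?thesis using s
      face_of_convex_hull_affine_independent[OF independent_face] by blast
  qed
qed

lemma Union_realization: "\<Union>realization = (\<Union>M\<in>F. convex hull M)"
proof -
  have "convex hull \<sigma> \<subseteq> (\<Union>M\<in>F. convex hull M)" if face: "\<sigma> \<in> faces" for \<sigma>
  proof -
    obtain M where "M \<in> F" "\<sigma> \<subseteq> M" using face by (auto simp: faces_def)
    then show ?thesis using hull_mono[of \<sigma> M convex] by blast
  qed
  then show ?thesis using facet_in_faces unfolding realization_def by blast
qed

lemma vertices_realization: "complex_vertices realization = \<Union>F"
proof (intro equalityI subsetI)
  fix v assume "v \<in> complex_vertices realization"
  then obtain \<sigma> where s: "\<sigma> \<in> faces" "{v} = convex hull \<sigma>"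
    by (auto simp: complex_vertices_def realization_def)
  then have "\<sigma> \<subseteq> {v}" "\<sigma> \<noteq> {}" using hull_subset[of \<sigma> convex] by auto
  then show "v \<in> \<Union>F" using face_vertices[OF s(1)] by auto
next
  fix v assume "v \<in> \<Union>F"
  then have "{v} \<in> faces" by (auto simp: faces_def)
  then have "convex hull {v} \<in> realization" unfolding realization_def by blast
  then show "v \<in> complex_vertices realization" by (simp add: complex_vertices_def)
qed

end

section \<open>Complexes whose facets are triangles\<close>

locale planar_hat_functions = hat_functions +
  assumes card_facet: "M \<in> F \<Longrightarrow> card M = 3"
begin

lemma face_card_3:
  assumes "\<sigma> \<in> faces"
  shows "card \<sigma> = 3 \<longleftrightarrow> \<sigma> \<in> F"
proof
  obtain M where "M \<in> F" "\<sigma> \<subseteq> M" using assms by (auto simp: faces_def)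
  moreover assume "card \<sigma> = 3"
  ultimately show "\<sigma> \<in> F"
    using card_subset_eq[of M \<sigma>] card_facet finite_facet by simp
qed (rule card_facet)

lemma triangles_realization: "complex_triangles realization = (\<lambda>M. convex hull M) ` F"
proof -
  have "2 simplex (convex hull \<sigma>) \<longleftrightarrow> \<sigma> \<in> F" if "\<sigma> \<in> faces" for \<sigma>
    using simplex_face_iff[OF that, of 2] face_card_3[OF that] by auto
  then show ?thesis
    unfolding complex_triangles_def realization_def using facet_in_faces by blast
qed

text \<open>\<open>strictly_Delaunay\<close> quantifies over arbitrary points spanning a triangle.
  The extreme points of the hull of a facet are exactly its vertices and must occur among the
  spanning points; counting then gives equality.\<close>

lemma vertices_of_triangle:
  assumes "convex hull {A, B, C} \<in> complex_triangles realization"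
  shows "{A, B, C} \<in> F"
proof -
  obtain M where M: "M \<in> F" "convex hull {A, B, C} = convex hull M"
    using assms triangles_realization by auto
  have "M \<subseteq> {A, B, C}"
    using extreme_point_of_convex_hull_affine_independent[OF independent_facet[OF M(1)]]
      extreme_point_of_convex_hull[of _ "{A, B, C}"] M(2) by auto
  moreover have "card M = 3" "card {A, B, C} \<le> 3"
    using M card_facet by (auto simp: card_insert_if)
  ultimately have "M = {A, B, C}" by (intro card_seteq) auto
  then show ?thesis using M by simp
qed

text \<open>Taking hulls is injective on faces and respects inclusion both ways, so uniqueness of
  the incident triangle is a question about vertex sets.\<close>

lemma boundary_edge_iff:
  assumes "{a, b} \<in> faces" "a \<noteq> b"
  shows "convex hull {a, b} \<in> boundary_edges realization \<longleftrightarrow> (\<exists>!M. M \<in> F \<and> {a, b} \<subseteq> M)"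
proof -
  have "1 simplex (convex hull {a, b})" using simplex_face_iff[OF assms(1)] assms by simp
  moreover have "convex hull {a, b} \<in> realization" using assms by (auto simp: realization_def)
  moreover have "(\<exists>!S. S \<in> complex_triangles realization \<and> convex hull {a, b} \<subseteq> S) \<longleftrightarrow>
      (\<exists>!M. M \<in> F \<and> {a, b} \<subseteq> M)"
  proof -
    have "{S. S \<in> complex_triangles realization \<and> convex hull {a, b} \<subseteq> S} =
        (\<lambda>M. convex hull M) ` {M. M \<in> F \<and> {a, b} \<subseteq> M}"
      unfolding triangles_realization using hull_subset_iff[OF assms(1) facet_in_faces] by blast
    moreover have "inj_on (\<lambda>M. convex hull M) {M. M \<in> F \<and> {a, b} \<subseteq> M}"
      using hull_eq_iff facet_in_faces by (auto simp: inj_on_def)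
    ultimately have "is_singleton {S. S \<in> complex_triangles realization \<and> convex hull {a, b} \<subseteq> S}
        \<longleftrightarrow> is_singleton {M. M \<in> F \<and> {a, b} \<subseteq> M}"
      by (simp add: is_singleton_altdef card_image)
    moreover have "is_singleton {x. Q x} \<longleftrightarrow> (\<exists>!x. Q x)" for Q :: "'a set \<Rightarrow> bool"
      by (auto simp: is_singleton_def)
    ultimately show ?thesis by simp
  qed
  ultimately show ?thesis by (auto simp: boundary_edges_def)
qed

lemma boundary_vertex_iff:
  "a \<in> boundary_vertices realization \<longleftrightarrow>
    (\<exists>b. b \<noteq> a \<and> (\<exists>!M. M \<in> F \<and> {a, b} \<subseteq> M))" (is "?L \<longleftrightarrow> ?R")
proof
  assume ?L
  then obtain e where e: "e \<in> boundary_edges realization" "a \<in> e" and a: "a \<in> \<Union>F"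
    unfolding boundary_vertices_def vertices_realization by blast
  have "e \<in> realization \<and> 1 simplex e \<and> (\<exists>!S. S \<in> complex_triangles realization \<and> e \<subseteq> S)"
    using e(1) unfolding boundary_edges_def mem_Collect_eq .
  then have e': "e \<in> realization" "1 simplex e" by (rule conjunct1, elim conjunct2[THEN conjunct1])
  then obtain \<sigma> where s: "\<sigma> \<in> faces" "e = convex hull \<sigma>" by (auto simp: realization_def)
  then have "card \<sigma> = 2" using e'(2) simplex_face_iff[OF s(1), of 1] by simp
  moreover have "a \<in> \<sigma>" using vertex_in_hull_iff[OF s(1) a] e s by simp
  ultimately obtain b where b: "\<sigma> = {a, b}" "a \<noteq> b"
    unfolding card_2_iff by (metis insertE insert_commute singletonD)
  have "{a, b} \<in> faces" by (rule s(1)[unfolded b(1)])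
  note edge = boundary_edge_iff[OF this b(2)]
  have "convex hull {a, b} \<in> boundary_edges realization" by (rule e(1)[unfolded s(2) b(1)])
  then have M: "\<exists>!M. M \<in> F \<and> {a, b} \<subseteq> M" unfolding edge .
  show ?R
    by (rule exI[of _ b], rule conjI, rule not_sym, rule b(2), rule M)
next
  assume ?R
  then obtain b where b: "b \<noteq> a" and b': "\<exists>!M. M \<in> F \<and> {a, b} \<subseteq> M" by (elim exE conjE)
  from b' obtain M where M: "M \<in> F" "{a, b} \<subseteq> M" by (elim ex1E conjE)
  then have "{a, b} \<in> faces" by (auto simp: faces_def)
  from boundary_edge_iff[OF this not_sym[OF b]] b'
  have "convex hull {a, b} \<in> boundary_edges realization" by (rule iffD2)
  moreover have "a \<in> convex hull {a, b}" by (simp add: hull_inc)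
  moreover have "a \<in> \<Union>F" using M by blast
  ultimately show ?L unfolding boundary_vertices_def vertices_realization by blast
qed

text \<open>The global empty-circle condition: all vertices off a facet lie outside its circle, not
  only those of adjacent triangles. In this form each facet is checked on its own.\<close>

lemma strictly_DelaunayI:
  assumes "\<And>M. M \<in> F \<Longrightarrow> \<exists>z r. \<phi> ` M \<subseteq> sphere z r \<and> (\<forall>D\<in>\<Union>F - M. \<phi> D \<notin> cball z r)"
  shows "strictly_Delaunay realization \<phi>"
  unfolding strictly_Delaunay_def
proof (intro allI impI, elim conjE)
  fix A B C D
  assume ABC: "convex hull {A, B, C} \<in> complex_triangles realization"
    and ABD: "convex hull {A, B, D} \<in> complex_triangles realization"
    and neq: "convex hull {A, B, C} \<noteq> convex hull {A, B, D}"
  have M: "{A, B, C} \<in> F" and M': "{A, B, D} \<in> F"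
    using ABC ABD by (simp_all add: vertices_of_triangle)
  have "D \<notin> {A, B}" using card_facet[OF M'] by (auto simp: card_insert_if split: if_splits)
  moreover have "D \<noteq> C" using neq by auto
  ultimately have "D \<in> \<Union>F - {A, B, C}" using M' by (intro DiffI UnionI) auto
  then show "\<exists>z r. {\<phi> A, \<phi> B, \<phi> C} \<subseteq> sphere z r \<and> \<phi> D \<notin> cball z r"
    using assms[OF M] by fastforce
qed

end

section \<open>The triangulated hexagon\<close>

definition pt :: "real \<Rightarrow> real \<Rightarrow> real^2"
  where "pt x y = vector [x, y]"

lemma pt_nth [simp]: "pt x y $ 1 = x" "pt x y $ 2 = y"
  by (simp_all add: pt_def)

lemma pt_eq_iff [simp]: "pt x y = pt x' y' \<longleftrightarrow> x = x' \<and> y = y'"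
  by (auto simp: vec_eq_iff forall_2)

lemma vec2_eq_iff: "(p::real^2) = q \<longleftrightarrow> p$1 = q$1 \<and> p$2 = q$2"
  by (auto simp: vec_eq_iff forall_2)

lemma dist_vec2: "dist (p::real^2) q = sqrt ((p$1 - q$1)\<^sup>2 + (p$2 - q$2)\<^sup>2)"
  by (simp add: dist_vec_def L2_set_def UNIV_2 dist_real_def)

text \<open>The interior vertex sits at the origin, halfway between the two Delaunay positions, and
  the identity serves as the reference triangulation. The order is top, bottom, right, left, upper,
  lower.\<close>

definition facets :: "(real^2) set set"
  where "facets =
    {{pt 2 1, pt (-2) 1, pt 0 5}, {pt 2 (-1), pt (-2) (-1), pt 0 (-5)},
     {pt 0 0, pt 2 1, pt 2 (-1)}, {pt 0 0, pt (-2) 1, pt (-2) (-1)},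
     {pt 0 0, pt 2 1, pt (-2) 1}, {pt 0 0, pt 2 (-1), pt (-2) (-1)}}"

text \<open>One minus the norm whose unit ball is the rectangle, cut off at zero. Its creases are
  the diagonals and the sides of the rectangle, hence edges of the triangulation.\<close>

definition bump :: "real^2 \<Rightarrow> real"
  where "bump x = max 0 (1 - max \<bar>x$1 / 2\<bar> \<bar>x$2\<bar>)"

text \<open>The products with the coordinates of \<open>v\<close> reflect \<open>x\<close> towards
  \<open>v\<close>, so one formula covers both apexes and another all four corners. For a corner,
  \<open>min\<close> changes branch at the long side of the rectangle, where the slope of the inner
  triangles gives way to that of the tall one.\<close>

definition hat :: "real^2 \<Rightarrow> real^2 \<Rightarrow> real"
  where "hat v x =
    (if v = pt 0 0 then bump x
     else if v$1 = 0 then max 0 ((v$2 * x$2 / 5 - 1) / 4)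
     else max 0 (v$1 * x$1 / 4 + min (v$2 * x$2) (5/4 - v$2 * x$2 / 4)) / 2)"

lemma Union_facets: "\<Union>facets = {pt 0 0, pt 2 1, pt 2 (-1), pt (-2) 1, pt (-2) (-1), pt 0 5, pt 0 (-5)}"
  by (auto simp: facets_def)

text \<open>On each facet the point is written out in coordinates; the claim for all seven vertices
  is then linear arithmetic in the weights with \<open>max\<close>, \<open>min\<close> and absolute
  values.\<close>

interpretation planar_hat_functions facets hat
proof
  fix \<sigma> v and c :: "real^2 \<Rightarrow> real"
  assume *: "\<sigma> \<in> facets" "v \<in> \<Union>facets" "\<And>w. w \<in> \<sigma> \<Longrightarrow> 0 \<le> c w" "sum c \<sigma> = 1"
  have c: "\<forall>w\<in>\<sigma>. 0 \<le> c w" using * by auto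
  from *(1) consider "\<sigma> = {pt 2 1, pt (-2) 1, pt 0 5}" | "\<sigma> = {pt 2 (-1), pt (-2) (-1), pt 0 (-5)}"
    | "\<sigma> = {pt 0 0, pt 2 1, pt 2 (-1)}" | "\<sigma> = {pt 0 0, pt (-2) 1, pt (-2) (-1)}"
    | "\<sigma> = {pt 0 0, pt 2 1, pt (-2) 1}" | "\<sigma> = {pt 0 0, pt 2 (-1), pt (-2) (-1)}"
    by (auto simp: facets_def)
  then have "\<forall>v\<in>\<Union>facets. hat v (\<Sum>w\<in>\<sigma>. c w *\<^sub>R w) = (if v \<in> \<sigma> then c v else 0)"
  proof cases
    case 1
    have x: "(\<Sum>w\<in>\<sigma>. c w *\<^sub>R w) = pt (2 * c (pt 2 1) - 2 * c (pt (-2) 1)) (c (pt 2 1) + c (pt (-2) 1) + 5 * c (pt 0 5))"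
      unfolding 1 by (simp add: vec2_eq_iff)
    show ?thesis
      unfolding x unfolding Union_facets using c *(4) unfolding 1
      by (simp add: hat_def bump_def add_divide_distrib diff_divide_distrib, elim conjE, (intro conjI)?, linarith+)
  next
    case 2
    have x: "(\<Sum>w\<in>\<sigma>. c w *\<^sub>R w) = pt (2 * c (pt 2 (-1)) - 2 * c (pt (-2) (-1))) (- c (pt 2 (-1)) - c (pt (-2) (-1)) - 5 * c (pt 0 (-5)))"
      unfolding 2 by (simp add: vec2_eq_iff)
    show ?thesis
      unfolding x unfolding Union_facets using c *(4) unfolding 2
      by (simp add: hat_def bump_def add_divide_distrib diff_divide_distrib, elim conjE, (intro conjI)?, linarith+)
  next
    case 3
    have x: "(\<Sum>w\<in>\<sigma>. c w *\<^sub>R w) = pt (2 * c (pt 2 1) + 2 * c (pt 2 (-1))) (c (pt 2 1) - c (pt 2 (-1)))"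
      unfolding 3 by (simp add: vec2_eq_iff)
    show ?thesis
      unfolding x unfolding Union_facets using c *(4) unfolding 3
      by (simp add: hat_def bump_def add_divide_distrib diff_divide_distrib, elim conjE, (intro conjI)?, linarith+)
  next
    case 4
    have x: "(\<Sum>w\<in>\<sigma>. c w *\<^sub>R w) = pt (- 2 * c (pt (-2) 1) - 2 * c (pt (-2) (-1))) (c (pt (-2) 1) - c (pt (-2) (-1)))"
      unfolding 4 by (simp add: vec2_eq_iff)
    show ?thesis
      unfolding x unfolding Union_facets using c *(4) unfolding 4
      by (simp add: hat_def bump_def add_divide_distrib diff_divide_distrib, elim conjE, (intro conjI)?, linarith+)
  next
    case 5
    have x: "(\<Sum>w\<in>\<sigma>. c w *\<^sub>R w) = pt (2 * c (pt 2 1) - 2 * c (pt (-2) 1)) (c (pt 2 1) + c (pt (-2) 1))"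
      unfolding 5 by (simp add: vec2_eq_iff)
    show ?thesis
      unfolding x unfolding Union_facets using c *(4) unfolding 5
      by (simp add: hat_def bump_def add_divide_distrib diff_divide_distrib, elim conjE, (intro conjI)?, linarith+)
  next
    case 6
    have x: "(\<Sum>w\<in>\<sigma>. c w *\<^sub>R w) = pt (2 * c (pt 2 (-1)) - 2 * c (pt (-2) (-1))) (- c (pt 2 (-1)) - c (pt (-2) (-1)))"
      unfolding 6 by (simp add: vec2_eq_iff)
    show ?thesis
      unfolding x unfolding Union_facets using c *(4) unfolding 6
      by (simp add: hat_def bump_def add_divide_distrib diff_divide_distrib, elim conjE, (intro conjI)?, linarith+)
  qed
  with *(2) show "hat v (\<Sum>w\<in>\<sigma>. c w *\<^sub>R w) = (if v \<in> \<sigma> then c v else 0)" by blast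
qed (auto simp: facets_def)

section \<open>The six triangles as sets of inequalities\<close>

lemma in_hull_3_iff:
  "x \<in> convex hull {a, b, c :: real^2} \<longleftrightarrow>
    (\<exists>u v w. 0 \<le> u \<and> 0 \<le> v \<and> 0 \<le> w \<and> u + v + w = 1 \<and>
      x$1 = u * a$1 + v * b$1 + w * c$1 \<and> x$2 = u * a$2 + v * b$2 + w * c$2)"
  by (auto simp: convex_hull_3 vec2_eq_iff)

lemma in_hull_3I:
  "0 \<le> u \<Longrightarrow> 0 \<le> v \<Longrightarrow> 0 \<le> w \<Longrightarrow> u + v + w = 1 \<Longrightarrow>
    x$1 = u * a$1 + v * b$1 + w * c$1 \<Longrightarrow> x$2 = u * a$2 + v * b$2 + w * c$2 \<Longrightarrow>
    x \<in> convex hull {a, b, c :: real^2}"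
  unfolding in_hull_3_iff by blast

text \<open>The witnesses here and in the next five lemmas are the barycentric coordinates, given on
  this triangle by the \<open>hat\<close> of its vertices; the inequalities express their
  nonnegativity.\<close>

lemma hull_top: "convex hull {pt 2 1, pt (-2) 1, pt 0 5} = {x. 1 \<le> x$2 \<and> x$2 + 2 * \<bar>x$1\<bar> \<le> 5}"
proof (intro equalityI subsetI; clarify)
  fix x :: "real^2" assume "1 \<le> x$2" "x$2 + 2 * \<bar>x$1\<bar> \<le> 5"
  then show "x \<in> convex hull {pt 2 1, pt (-2) 1, pt 0 5}"
    by (intro in_hull_3I[where u = "5 / 8 - x$2 / 8 + x$1 / 4" and v = "5 / 8 - x$2 / 8 - x$1 / 4"
        and w = "x$2 / 4 - 1 / 4"]) auto
qed (auto simp: in_hull_3_iff abs_if)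

lemma hull_bottom:
  "convex hull {pt 2 (-1), pt (-2) (-1), pt 0 (-5)} = {x. x$2 \<le> -1 \<and> - x$2 + 2 * \<bar>x$1\<bar> \<le> 5}"
proof (intro equalityI subsetI; clarify)
  fix x :: "real^2" assume "x$2 \<le> -1" "- x$2 + 2 * \<bar>x$1\<bar> \<le> 5"
  then show "x \<in> convex hull {pt 2 (-1), pt (-2) (-1), pt 0 (-5)}"
    by (intro in_hull_3I[where u = "5 / 8 + x$2 / 8 + x$1 / 4" and v = "5 / 8 + x$2 / 8 - x$1 / 4"
        and w = "- x$2 / 4 - 1 / 4"]) auto
qed (auto simp: in_hull_3_iff abs_if)

lemma hull_right: "convex hull {pt 0 0, pt 2 1, pt 2 (-1)} = {x. 2 * \<bar>x$2\<bar> \<le> x$1 \<and> x$1 \<le> 2}"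
proof (intro equalityI subsetI; clarify)
  fix x :: "real^2" assume "2 * \<bar>x$2\<bar> \<le> x$1" "x$1 \<le> 2"
  then show "x \<in> convex hull {pt 0 0, pt 2 1, pt 2 (-1)}"
    by (intro in_hull_3I[where u = "1 - x$1 / 2" and v = "x$1 / 4 + x$2 / 2"
        and w = "x$1 / 4 - x$2 / 2"]) auto
qed (auto simp: in_hull_3_iff abs_if)

lemma hull_left: "convex hull {pt 0 0, pt (-2) 1, pt (-2) (-1)} = {x. 2 * \<bar>x$2\<bar> \<le> - x$1 \<and> -2 \<le> x$1}"
proof (intro equalityI subsetI; clarify)
  fix x :: "real^2" assume "2 * \<bar>x$2\<bar> \<le> - x$1" "-2 \<le> x$1"
  then show "x \<in> convex hull {pt 0 0, pt (-2) 1, pt (-2) (-1)}"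
    by (intro in_hull_3I[where u = "1 + x$1 / 2" and v = "x$2 / 2 - x$1 / 4"
        and w = "- x$1 / 4 - x$2 / 2"]) auto
qed (auto simp: in_hull_3_iff abs_if)

lemma hull_upper: "convex hull {pt 0 0, pt 2 1, pt (-2) 1} = {x. \<bar>x$1\<bar> \<le> 2 * x$2 \<and> x$2 \<le> 1}"
proof (intro equalityI subsetI; clarify)
  fix x :: "real^2" assume "\<bar>x$1\<bar> \<le> 2 * x$2" "x$2 \<le> 1"
  then show "x \<in> convex hull {pt 0 0, pt 2 1, pt (-2) 1}"
    by (intro in_hull_3I[where u = "1 - x$2" and v = "x$1 / 4 + x$2 / 2"
        and w = "x$2 / 2 - x$1 / 4"]) auto
qed (auto simp: in_hull_3_iff abs_if)

lemma hull_lower: "convex hull {pt 0 0, pt 2 (-1), pt (-2) (-1)} = {x. \<bar>x$1\<bar> \<le> - 2 * x$2 \<and> -1 \<le> x$2}"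
proof (intro equalityI subsetI; clarify)
  fix x :: "real^2" assume "\<bar>x$1\<bar> \<le> - 2 * x$2" "-1 \<le> x$2"
  then show "x \<in> convex hull {pt 0 0, pt 2 (-1), pt (-2) (-1)}"
    by (intro in_hull_3I[where u = "1 + x$2" and v = "x$1 / 4 - x$2 / 2"
        and w = "- x$2 / 2 - x$1 / 4"]) auto
qed (auto simp: in_hull_3_iff abs_if)

lemmas hull_facets = hull_top hull_bottom hull_right hull_left hull_upper hull_lower

section \<open>The hexagon as a convex polygon and a disk\<close>

definition hexagon :: "(real^2) set"
  where "hexagon = {x. \<bar>x$1\<bar> \<le> 2 \<and> \<bar>x$2\<bar> + 2 * \<bar>x$1\<bar> \<le> 5}"

lemma Union_hull_facets: "(\<Union>M\<in>facets. convex hull M) = hexagon"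
  unfolding facets_def hexagon_def by (auto simp: hull_facets)

text \<open>Both bounded quantities are convex functions of the point, so their sublevel sets are
  convex.\<close>

lemma convex_hexagon: "convex hexagon"
proof (rule convexI)
  fix x y :: "real^2" and u v :: real
  assume *: "x \<in> hexagon" "y \<in> hexagon" "0 \<le> u" "0 \<le> v" "u + v = 1"
  have b: "u * a + v * b \<le> c" if "a \<le> c" "b \<le> c" for a b c
    using convex_bound_le[OF that *(3-5)] .
  have abs: "\<bar>u * a + v * b\<bar> \<le> u * \<bar>a\<bar> + v * \<bar>b\<bar>" for a b
    using abs_triangle_ineq[of "u * a" "v * b"] *(3,4) by (simp add: abs_mult)
  have "u * \<bar>x$1\<bar> + v * \<bar>y$1\<bar> \<le> 2"
    "u * (\<bar>x$2\<bar> + 2 * \<bar>x$1\<bar>) + v * (\<bar>y$2\<bar> + 2 * \<bar>y$1\<bar>) \<le> 5"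
    using *(1,2) by (auto simp: hexagon_def intro!: b)
  with abs[of "x$1" "y$1"] abs[of "x$2" "y$2"] show "u *\<^sub>R x + v *\<^sub>R y \<in> hexagon"
    by (simp add: hexagon_def algebra_simps)
qed

lemma hexagon_eq_hull: "hexagon = convex hull (\<Union>facets)"
proof
  show "hexagon \<subseteq> convex hull (\<Union>facets)"
    unfolding Union_hull_facets[symmetric] by (intro UN_least hull_mono) blast
  show "convex hull (\<Union>facets) \<subseteq> hexagon"
    by (rule hull_minimal[of _ _ convex, OF _ convex_hexagon]) (auto simp: Union_facets hexagon_def)
qed

lemma compact_hexagon: "compact hexagon"
  unfolding hexagon_eq_hull by (intro compact_convex_hull finite_imp_compact) (simp add: Union_facets)

lemma interior_hexagon: "interior hexagon \<noteq> {}"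
proof -
  have "x \<in> hexagon" if "x \<in> ball 0 1" for x
    using that component_le_norm_cart[of x "1::2"] component_le_norm_cart[of x "2::2"]
    by (simp add: hexagon_def)
  then have "ball 0 1 \<subseteq> hexagon" by blast
  then show ?thesis by (metis centre_in_ball empty_iff interior_maximal open_ball subsetD zero_less_one)
qed

lemma convex_polygon_hexagon: "convex_polygon hexagon"
proof -
  have "polytope hexagon"
    unfolding hexagon_eq_hull by (intro polytope_convex_hull) (simp add: Union_facets)
  then show ?thesis
    using aff_dim_nonempty_interior[OF interior_hexagon] by (simp add: convex_polygon_def)
qed

lemma Union_realization_facets: "\<Union>realization = hexagon"
  using Union_realization Union_hull_facets by simp

lemma disk_complex_realization: "disk_complex realization"
proof -
  have "aff_dim S \<le> 2" for S :: "(real^2) set"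
    using aff_dim_le_DIM[of S] by simp
  moreover have "\<exists>S\<in>realization. aff_dim S = 2"
  proof -
    obtain M where M: "M \<in> facets" by (auto simp: facets_def)
    then have "2 simplex (convex hull M)" "convex hull M \<in> realization"
      using triangles_realization by (auto simp: complex_triangles_def)
    then show ?thesis using aff_dim_simplex by blast
  qed
  moreover have "hexagon homeomorphic cball (0::real^2) 1"
    using homeomorphic_convex_compact_cball[OF convex_hexagon compact_hexagon interior_hexagon] by simp
  ultimately show ?thesis
    using simplicial_complex_realization by (simp add: disk_complex_def Union_realization_facets)
qed

section \<open>Moving the interior vertex\<close>

text \<open>\<open>slide s\<close> moves the interior vertex from the origin to \<open>(s, 0)\<close> and is affine on each triangle,
  because \<open>bump\<close> is the hat function of the origin.\<close>

definition slide :: "real \<Rightarrow> real^2 \<Rightarrow> real^2"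
  where "slide s x = x + (s * bump x) *\<^sub>R pt 1 0"

lemma slide_nth [simp]: "slide s x $ 1 = x$1 + s * bump x" "slide s x $ 2 = x$2"
  by (simp_all add: slide_def)

lemma slide_0: "slide 0 = (\<lambda>x. x)"
  by (simp add: slide_def fun_eq_iff)

lemma continuous_on_bump [continuous_intros]: "continuous_on A f \<Longrightarrow> continuous_on A (\<lambda>x. bump (f x))"
  unfolding bump_def by (intro continuous_intros) auto

text \<open>Truncation does not increase distances, so the slope along a horizontal line is at most
  that of \<open>\<bar>x$1 / 2\<bar>\<close>. The factor one half keeps \<open>slide s\<close>
  injective for \<open>\<bar>s\<bar> \<le> 1\<close>.\<close>

lemma bump_lipschitz:
  assumes "x$2 = y$2"
  shows "2 * \<bar>bump x - bump y\<bar> \<le> \<bar>x$1 - y$1\<bar>"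
proof -
  have "\<bar>max 0 (1 - max a c) - max 0 (1 - max b c)\<bar> \<le> \<bar>a - b\<bar>" for a b c :: real
    by linarith
  from this[of "\<bar>x$1 / 2\<bar>" "\<bar>y$2\<bar>" "\<bar>y$1 / 2\<bar>"] have "\<bar>bump x - bump y\<bar> \<le> \<bar>\<bar>x$1 / 2\<bar> - \<bar>y$1 / 2\<bar>\<bar>"
    unfolding bump_def assms .
  moreover have "2 * \<bar>\<bar>a / 2\<bar> - \<bar>b / 2\<bar>\<bar> \<le> \<bar>a - b\<bar>" for a b :: real by (auto simp: abs_if)
  from this[of "x$1" "y$1"] have "2 * \<bar>\<bar>x$1 / 2\<bar> - \<bar>y$1 / 2\<bar>\<bar> \<le> \<bar>x$1 - y$1\<bar>" .
  ultimately show ?thesis by (meson mult_left_mono order_trans zero_le_numeral)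
qed

text \<open>Points move along horizontal lines, so bijectivity is a one-dimensional question;
  compactness supplies the continuous inverse.\<close>

lemma slide_homeomorphism:
  assumes "\<bar>s\<bar> \<le> 1"
  shows "\<exists>g. homeomorphism hexagon hexagon (slide s) g"
proof (rule homeomorphism_compact[OF compact_hexagon])
  show "continuous_on hexagon (slide s)"
    unfolding slide_def by (intro continuous_intros)
  show "inj_on (slide s) hexagon"
  proof (rule inj_onI)
    fix x y assume "slide s x = slide s y"
    then have 2: "x$2 = y$2" and 1: "x$1 - y$1 = s * (bump y - bump x)"
      by (simp_all add: vec2_eq_iff algebra_simps)
    have "\<bar>x$1 - y$1\<bar> \<le> 1 * \<bar>bump y - bump x\<bar>"
      unfolding 1 abs_mult by (rule mult_right_mono[OF assms]) simp
    \<comment> \<open>The two bounds combine to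
      \<open>\<bar>x$1 - y$1\<bar> \<le> \<bar>x$1 - y$1\<bar> / 2\<close>.\<close>
    with bump_lipschitz[OF 2] abs_minus_commute[of "bump x" "bump y"] have "\<bar>x$1 - y$1\<bar> \<le> 0" by argo
    with 2 show "x = y" by (simp add: vec2_eq_iff)
  qed
  have bound: "\<bar>s * bump x\<bar> \<le> bump x" for x
    using mult_right_mono[OF assms, of "bump x"] by (simp add: abs_mult bump_def)
  show "slide s ` hexagon = hexagon"
  proof (intro equalityI subsetI)
    fix y assume "y \<in> slide s ` hexagon"
    then obtain x where x: "x \<in> hexagon" "y = slide s x" by auto
    show "y \<in> hexagon"
    proof (cases "bump x = 0")
      case True
      then show ?thesis using x by (simp add: slide_def)
    next
      case False
      then have "bump x = 1 - max \<bar>x$1 / 2\<bar> \<bar>x$2\<bar>" "0 < bump x" unfolding bump_def by linarith+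
      \<comment> \<open>As \<open>bump x \<le> 1 - \<bar>x$1\<bar> / 2\<close>, the new first
        coordinate is at most \<open>1 + \<bar>x$1\<bar> / 2\<close> in size, and the point stays in
        the rectangle.\<close>
      then have "\<bar>x$1 + s * bump x\<bar> \<le> 2" "\<bar>x$2\<bar> \<le> 1" using bound[of x] by linarith+
      then show ?thesis unfolding x hexagon_def by simp
    qed
  next
    fix y assume y: "y \<in> hexagon"
    show "y \<in> slide s ` hexagon"
    proof (cases "\<bar>y$2\<bar> \<le> 1")
      case False
      then have "slide s y = y" by (simp add: slide_def bump_def)
      then show ?thesis using y by force
    next
      case True
      \<comment> \<open>\<open>bump\<close> vanishes at the ends -2 and 2, which therefore stay
        fixed and enclose \<open>y$1\<close>.\<close>
      have "\<exists>t. -2 \<le> t \<and> t \<le> 2 \<and> t + s * bump (pt t (y$2)) = y$1"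
      proof (rule IVT')
        show "continuous_on {-2..2} (\<lambda>t. t + s * bump (pt t (y$2)))"
          unfolding bump_def by (auto intro!: continuous_intros)
      qed (use y in \<open>auto simp: bump_def hexagon_def\<close>)
      then obtain t where t: "-2 \<le> t" "t \<le> 2" "t + s * bump (pt t (y$2)) = y$1" by auto
      then have "slide s (pt t (y$2)) = y" by (simp add: vec2_eq_iff)
      moreover have "pt t (y$2) \<in> hexagon" using t True by (auto simp: hexagon_def)
      ultimately show ?thesis by force
    qed
  qed
qed

lemma slide_affine:
  assumes "\<And>x. x \<in> S \<Longrightarrow> bump x = u \<bullet> x + d"
  shows "\<exists>L b. linear L \<and> (\<forall>x\<in>S. slide s x = L x + b)"
proof (intro exI conjI ballI)
  show "linear (\<lambda>x. x + (s * (u \<bullet> x)) *\<^sub>R pt 1 0)"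
    by (rule linearI) (simp_all add: inner_add_right algebra_simps)
  show "slide s x = x + (s * (u \<bullet> x)) *\<^sub>R pt 1 0 + (s * d) *\<^sub>R pt 1 0" if "x \<in> S" for x
    using assms[OF that] by (simp add: slide_def algebra_simps)
qed

text \<open>In the order of \<open>facets\<close>, \<open>bump\<close> is 0, 0,
  \<open>1 - x$1 / 2\<close>, \<open>1 + x$1 / 2\<close>, \<open>1 - x$2\<close>,
  \<open>1 + x$2\<close>.\<close>

lemma bump_affine:
  assumes "M \<in> facets"
  obtains u d where "\<And>x. x \<in> convex hull M \<Longrightarrow> bump x = u \<bullet> x + d"
proof -
  have inner: "pt a b \<bullet> x = a * x$1 + b * x$2" for a b x
    by (simp add: inner_vec_def UNIV_2)
  from assms consider "M = {pt 2 1, pt (-2) 1, pt 0 5}" | "M = {pt 2 (-1), pt (-2) (-1), pt 0 (-5)}"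
    | "M = {pt 0 0, pt 2 1, pt 2 (-1)}" | "M = {pt 0 0, pt (-2) 1, pt (-2) (-1)}"
    | "M = {pt 0 0, pt 2 1, pt (-2) 1}" | "M = {pt 0 0, pt 2 (-1), pt (-2) (-1)}"
    by (auto simp: facets_def)
  then show thesis
  proof cases
    case 1 show thesis by (rule that[of "pt 0 0" 0]) (simp add: 1 hull_facets inner bump_def; linarith)
  next
    case 2 show thesis by (rule that[of "pt 0 0" 0]) (simp add: 2 hull_facets inner bump_def; linarith)
  next
    case 3 show thesis by (rule that[of "pt (-1/2) 0" 1]) (simp add: 3 hull_facets inner bump_def; linarith)
  next
    case 4 show thesis by (rule that[of "pt (1/2) 0" 1]) (simp add: 4 hull_facets inner bump_def; linarith)
  next
    case 5 show thesis by (rule that[of "pt 0 (-1)" 1]) (simp add: 5 hull_facets inner bump_def; linarith)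
  next
    case 6 show thesis by (rule that[of "pt 0 1" 1]) (simp add: 6 hull_facets inner bump_def; linarith)
  qed
qed

lemma polygon_triangulation_slide:
  assumes "\<bar>s\<bar> \<le> 1"
  shows "polygon_triangulation realization hexagon (slide s)"
  unfolding polygon_triangulation_def Union_realization_facets triangles_realization
proof (intro conjI ballI)
  fix S assume "S \<in> (\<lambda>M. convex hull M) ` facets"
  then obtain M where M: "M \<in> facets" "S = convex hull M" by blast
  obtain u d where "\<And>x. x \<in> S \<Longrightarrow> bump x = u \<bullet> x + d" using bump_affine[OF M(1)] M(2) by metis
  then show "\<exists>L b. linear L \<and> (\<forall>x\<in>S. slide s x = L x + b)" by (rule slide_affine)
qed (rule slide_homeomorphism[OF assms])

text \<open>Scaling the displacement by time joins the identity to \<open>slide s\<close>; every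
  stage is a slide with parameter at most one in size.\<close>

lemma isotopic_slide:
  assumes "\<bar>s\<bar> \<le> 1"
  shows "isotopic_triangulations realization hexagon (\<lambda>x. x) (slide s)"
  unfolding isotopic_triangulations_def Union_realization_facets homotopic_with_def
proof (intro exI[of _ "\<lambda>p. slide (fst p * s) (snd p)"] conjI allI ballI)
  let ?h = "\<lambda>p. slide (fst p * s) (snd p)"
  have ts: "\<bar>t * s\<bar> \<le> 1" if "t \<in> {0..1}" for t
    using mult_mono[of t 1 "\<bar>s\<bar>" 1] that assms by (auto simp: abs_mult)
  show *: "\<exists>g. homeomorphism hexagon hexagon (\<lambda>x. ?h (t, x)) g" if "t \<in> {0..1}" for t
    using slide_homeomorphism[OF ts[OF that]] by simp
  have "slide (t * s) x \<in> hexagon" if "t \<in> {0..1}" "x \<in> hexagon" for t x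
    using slide_homeomorphism[OF ts[OF that(1)]] that(2) by (blast dest: homeomorphism_image1)
  then have "?h ` ({0..1} \<times> hexagon) \<subseteq> hexagon" by auto
  moreover have "continuous_on ({0..1} \<times> hexagon) ?h"
    unfolding slide_def by (intro continuous_intros)
  ultimately show "continuous_map (prod_topology (top_of_set {0..1}) (top_of_set hexagon)) (top_of_set hexagon) ?h"
    by (simp add: image_subset_iff_funcset flip: subtopology_Times)
qed (simp_all add: slide_0)

section \<open>The Delaunay condition at the two positions\<close>

lemma pt_in_sphere_iff: "0 \<le> R \<Longrightarrow> pt x y \<in> sphere (pt a b) (sqrt R) \<longleftrightarrow> (a - x)\<^sup>2 + (b - y)\<^sup>2 = R"
  by (simp add: dist_vec2)

lemma pt_in_cball_iff: "0 \<le> R \<Longrightarrow> pt x y \<in> cball (pt a b) (sqrt R) \<longleftrightarrow> (a - x)\<^sup>2 + (b - y)\<^sup>2 \<le> R"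
  by (simp add: dist_vec2)

lemma slide_vertex:
  "slide s (pt 0 0) = pt s 0" "slide s (pt 2 1) = pt 2 1" "slide s (pt 2 (-1)) = pt 2 (-1)"
  "slide s (pt (-2) 1) = pt (-2) 1" "slide s (pt (-2) (-1)) = pt (-2) (-1)"
  "slide s (pt 0 5) = pt 0 5" "slide s (pt 0 (-5)) = pt 0 (-5)"
  by (simp_all add: vec2_eq_iff bump_def)

text \<open>An explicit circle is given for each facet, with radius written as a square root so that
  every check compares rational squared distances.\<close>

lemma strictly_Delaunay_slide:
  assumes "s = 1 \<or> s = -1"
  shows "strictly_Delaunay realization (slide s)"
proof (rule strictly_DelaunayI)
  fix M assume "M \<in> facets"
  have circle: "\<exists>z r. slide s ` M \<subseteq> sphere z r \<and> (\<forall>D\<in>\<Union>facets - M. slide s D \<notin> cball z r)"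
    if "slide s ` M \<subseteq> sphere (pt a b) (sqrt R)"
      "\<forall>D\<in>\<Union>facets - M. slide s D \<notin> cball (pt a b) (sqrt R)" for a b R
    using that by blast
  note simps = Union_facets slide_vertex pt_in_sphere_iff pt_in_cball_iff power2_eq_square insert_Diff_if
  from \<open>M \<in> facets\<close> consider "M = {pt 2 1, pt (-2) 1, pt 0 5}" | "M = {pt 2 (-1), pt (-2) (-1), pt 0 (-5)}"
    | "M = {pt 0 0, pt 2 1, pt 2 (-1)}" | "M = {pt 0 0, pt (-2) 1, pt (-2) (-1)}"
    | "M = {pt 0 0, pt 2 1, pt (-2) 1}" | "M = {pt 0 0, pt 2 (-1), pt (-2) (-1)}"
    by (auto simp: facets_def)
  then show "\<exists>z r. slide s ` M \<subseteq> sphere z r \<and> (\<forall>D\<in>\<Union>facets - M. slide s D \<notin> cball z r)"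
  proof cases
    case 1 show ?thesis by (rule circle[of 0 "5/2" "25/4"])
      (use assms in \<open>auto simp: 1 simps simp del: mem_sphere mem_cball\<close>)
  next
    case 2 show ?thesis by (rule circle[of 0 "-5/2" "25/4"])
      (use assms in \<open>auto simp: 2 simps simp del: mem_sphere mem_cball\<close>)
  next
    \<comment> \<open>The centre is the point of the horizontal axis equidistant from
      \<open>(s, 0)\<close> and the two right corners; \<open>s\<^sup>2 = 1\<close> simplifies it to
      this form. The next case is its mirror image.\<close>
    case 3 show ?thesis by (rule circle[of "2 / (2 - s)" 0 "(2 / (2 - s) - s)\<^sup>2"])
      (use assms in \<open>auto simp: 3 simps simp del: mem_sphere mem_cball real_sqrt_mult_self real_sqrt_abs2\<close>)
  next
    case 4 show ?thesis by (rule circle[of "- 2 / (2 + s)" 0 "(2 / (2 + s) + s)\<^sup>2"])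
      (use assms in \<open>auto simp: 4 simps simp del: mem_sphere mem_cball real_sqrt_mult_self real_sqrt_abs2\<close>)
  next
    \<comment> \<open>Only \<open>s\<^sup>2 = 1\<close> enters the equation of the centre on the
      vertical axis, so one circle serves both signs.\<close>
    case 5 show ?thesis by (rule circle[of 0 2 5])
      (use assms in \<open>auto simp: 5 simps simp del: mem_sphere mem_cball\<close>)
  next
    case 6 show ?thesis by (rule circle[of 0 "-2" 5])
      (use assms in \<open>auto simp: 6 simps simp del: mem_sphere mem_cball\<close>)
  qed
qed

text \<open>Three outer edges already reach all six outer vertices. Every edge at the origin ends at
  a corner of the rectangle and lies in two facets.\<close>

lemma boundary_vertices_facets: "boundary_vertices realization = \<Union>facets - {pt 0 0}"
proof
  have "\<exists>!M. M \<in> facets \<and> {pt 2 1, pt 0 5} \<subseteq> M"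
    by (rule ex1I[of _ "{pt 2 1, pt (-2) 1, pt 0 5}"]) (auto simp: facets_def)
  moreover have "\<exists>!M. M \<in> facets \<and> {pt (-2) 1, pt (-2) (-1)} \<subseteq> M"
    by (rule ex1I[of _ "{pt 0 0, pt (-2) 1, pt (-2) (-1)}"]) (auto simp: facets_def)
  moreover have "\<exists>!M. M \<in> facets \<and> {pt 2 (-1), pt 0 (-5)} \<subseteq> M"
    by (rule ex1I[of _ "{pt 2 (-1), pt (-2) (-1), pt 0 (-5)}"]) (auto simp: facets_def)
  moreover have "a \<in> boundary_vertices realization \<and> b \<in> boundary_vertices realization"
    if "\<exists>!M. M \<in> facets \<and> {a, b} \<subseteq> M" "a \<noteq> b" for a b
    unfolding boundary_vertex_iff using that(1) that(1)[unfolded insert_commute[of a b]] that(2)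
    by (intro conjI exI[of _ a] exI[of _ b]) simp_all
  ultimately have "{pt 2 1, pt 0 5, pt (-2) 1, pt (-2) (-1), pt 2 (-1), pt 0 (-5)} \<subseteq> boundary_vertices realization"
    by simp
  then show "\<Union>facets - {pt 0 0} \<subseteq> boundary_vertices realization"
    unfolding Union_facets by blast
  have centre: "\<not> (\<exists>!M. M \<in> facets \<and> {pt 0 0, b} \<subseteq> M)" if "b \<noteq> pt 0 0" for b
  proof
    assume unique: "\<exists>!M. M \<in> facets \<and> {pt 0 0, b} \<subseteq> M"
    then obtain M where "M \<in> facets" "{pt 0 0, b} \<subseteq> M" by (elim ex1E conjE)
    then have "b \<in> {pt 2 1, pt 2 (-1), pt (-2) 1, pt (-2) (-1)}"
      using that by (auto simp: facets_def)
    moreover obtain M0 where M0: "\<forall>N. N \<in> facets \<and> {pt 0 0, b} \<subseteq> N \<longrightarrow> N = M0"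
      using unique by (elim ex1E)
    \<comment> \<open>Uniqueness would make any two facets on the edge coincide; for each corner,
      two facets with different third vertices refute this.\<close>
    have eq: "M \<subseteq> N" if "M \<in> facets" "N \<in> facets" "{pt 0 0, b} \<subseteq> M" "{pt 0 0, b} \<subseteq> N" for M N
      using M0[rule_format, OF conjI, OF that(1,3)] M0[rule_format, OF conjI, OF that(2,4)] by simp
    have "b \<noteq> pt 2 1"
      using eq[of "{pt 0 0, pt 2 1, pt 2 (-1)}" "{pt 0 0, pt 2 1, pt (-2) 1}"]
      by (auto simp: facets_def)
    moreover have "b \<noteq> pt 2 (-1)"
      using eq[of "{pt 0 0, pt 2 1, pt 2 (-1)}" "{pt 0 0, pt 2 (-1), pt (-2) (-1)}"]
      by (auto simp: facets_def)
    moreover have "b \<noteq> pt (-2) 1"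
      using eq[of "{pt 0 0, pt (-2) 1, pt (-2) (-1)}" "{pt 0 0, pt 2 1, pt (-2) 1}"]
      by (auto simp: facets_def)
    moreover have "b \<noteq> pt (-2) (-1)"
      using eq[of "{pt 0 0, pt (-2) 1, pt (-2) (-1)}" "{pt 0 0, pt 2 (-1), pt (-2) (-1)}"]
      by (auto simp: facets_def)
    ultimately show False by blast
  qed
  have "pt 0 0 \<notin> boundary_vertices realization"
  proof
    assume "pt 0 0 \<in> boundary_vertices realization"
    then obtain b where b: "b \<noteq> pt 0 0" "\<exists>!M. M \<in> facets \<and> {pt 0 0, b} \<subseteq> M"
      unfolding boundary_vertex_iff by (elim exE conjE)
    show False by (rule notE[OF centre[OF b(1)] b(2)])
  qed
  moreover have "boundary_vertices realization \<subseteq> \<Union>facets"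
    using vertices_realization by (auto simp: boundary_vertices_def)
  ultimately show "boundary_vertices realization \<subseteq> \<Union>facets - {pt 0 0}" by blast
qed

section \<open>Separation by the vertical axis\<close>

text \<open>The sign \<open>b\<close> treats top and bottom together. Equidistance forces centre
  \<open>(0, 5b/2)\<close> and radius 5/2, a circle through the origin with equation
  \<open>x\<^sup>2 + y\<^sup>2 = 5by\<close>.\<close>

lemma outside_tall_circle:
  assumes "{pt 2 b, pt (-2) b, pt 0 (5 * b)} \<subseteq> sphere z r" "p \<notin> cball z r" "b\<^sup>2 = 1"
  shows "5 * (b * p$2) < (p$1)\<^sup>2 + (p$2)\<^sup>2"
proof -
  have r: "0 \<le> r" using assms(1) by (auto simp: dist_vec2)
  have sq: "(z$1 - 2)\<^sup>2 + (z$2 - b)\<^sup>2 = r\<^sup>2" "(z$1 + 2)\<^sup>2 + (z$2 - b)\<^sup>2 = r\<^sup>2"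
    "(z$1)\<^sup>2 + (z$2 - 5 * b)\<^sup>2 = r\<^sup>2"
    using assms(1) by (auto simp: dist_vec2)
  have z1: "z$1 = 0" using sq(1,2) by (simp add: power2_eq_square algebra_simps)
  have "8 * (b * z$2) = 20"
    using sq(1,3) z1 assms(3) by (simp add: power2_eq_square algebra_simps)
  then have z2: "z$2 = 5/2 * b" using assms(3) by (auto simp: power2_eq_1_iff)
  have r2: "r\<^sup>2 = 25/4"
    using sq(3) z1 z2 assms(3) by (simp add: power2_eq_square algebra_simps)
  have "r\<^sup>2 < (dist z p)\<^sup>2" using assms(2) r by (intro power_strict_mono) auto
  also have "(dist z p)\<^sup>2 = (z$1 - p$1)\<^sup>2 + (z$2 - p$2)\<^sup>2" by (simp add: dist_vec2)
  finally show ?thesis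
    unfolding r2 z1 z2 using assms(3) by (simp add: power2_eq_square algebra_simps)
qed

text \<open>On the axis, being outside both tall circles means
  \<open>5 * \<bar>p$2\<bar> < (p$2)\<^sup>2\<close>, whereas points of the hexagon satisfy
  \<open>\<bar>p$2\<bar> \<le> 5\<close>.\<close>

lemma configuration_avoids_axis:
  assumes "g \<in> Delaunay_configurations realization hexagon (\<lambda>x. x)"
  shows "g (pt 0 0) $ 1 \<noteq> 0"
proof
  assume 0: "g (pt 0 0) $ 1 = 0"
  obtain \<phi> where g: "g = restrict \<phi> (\<Union>facets)"
    and tri: "polygon_triangulation realization hexagon \<phi>"
    and del: "strictly_Delaunay realization \<phi>"
    and fix_bd: "\<forall>v\<in>\<Union>facets - {pt 0 0}. \<phi> v = v"
    using assms unfolding Delaunay_configurations_def boundary_vertices_facets vertices_realization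
    by (elim CollectE exE conjE)
  define p where "p = \<phi> (pt 0 0)"
  have p1: "p$1 = 0" using 0 by (simp add: g p_def Union_facets)
  obtain \<phi>' where "homeomorphism hexagon hexagon \<phi> \<phi>'"
    using tri unfolding polygon_triangulation_def Union_realization_facets by (elim conjE exE)
  moreover have "pt 0 0 \<in> hexagon" by (simp add: hexagon_def)
  ultimately have "p \<in> hexagon" unfolding p_def by (metis homeomorphism_image1 imageI)
  then have p2: "\<bar>p$2\<bar> \<le> 5" by (simp add: hexagon_def p1)
  have tri: "convex hull M \<in> complex_triangles realization" if "M \<in> facets" for M
    unfolding triangles_realization using that by (rule imageI)
  have far: "5 * (b * p$2) < (p$1)\<^sup>2 + (p$2)\<^sup>2" if b: "b = 1 \<or> b = -1" for b
  proof -
    \<comment> \<open>\<open>strictly_Delaunay\<close> lists the shared edge first, so the inner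
      triangle is rewritten to begin with the long side.\<close>
    have "{pt 2 b, pt (-2) b, pt 0 0} = {pt 0 0, pt 2 b, pt (-2) b}" by blast
    moreover have "{pt 2 b, pt (-2) b, pt 0 (5 * b)} \<in> facets \<and> {pt 0 0, pt 2 b, pt (-2) b} \<in> facets"
      by (rule disjE[OF b]) (simp_all add: facets_def)
    ultimately have facets: "{pt 2 b, pt (-2) b, pt 0 (5 * b)} \<in> facets" "{pt 2 b, pt (-2) b, pt 0 0} \<in> facets"
      by (simp_all only:)
    have "pt 0 0 \<in> {pt 2 b, pt (-2) b, pt 0 0} - {pt 2 b, pt (-2) b, pt 0 (5 * b)}" using b by auto
    then have "{pt 2 b, pt (-2) b, pt 0 (5 * b)} \<noteq> {pt 2 b, pt (-2) b, pt 0 0}" by blast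
    then have "convex hull {pt 2 b, pt (-2) b, pt 0 (5 * b)} \<noteq> convex hull {pt 2 b, pt (-2) b, pt 0 0}"
      unfolding hull_eq_iff[OF facets[THEN facet_in_faces]] .
    with facets have "\<exists>z r. {\<phi> (pt 2 b), \<phi> (pt (-2) b), \<phi> (pt 0 (5 * b))} \<subseteq> sphere z r \<and> p \<notin> cball z r"
      unfolding p_def by (intro del[unfolded strictly_Delaunay_def, rule_format] conjI tri)
    then obtain z r where "{\<phi> (pt 2 b), \<phi> (pt (-2) b), \<phi> (pt 0 (5 * b))} \<subseteq> sphere z r" "p \<notin> cball z r"
      by (elim exE conjE)
    then show ?thesis
      using outside_tall_circle[of b z r p] b fix_bd by (auto simp: Union_facets)
  qed
  have "5 * \<bar>p$2\<bar> < (p$2)\<^sup>2" using far[of 1] far[of "-1"] p1 by (auto simp: abs_if)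
  moreover have "(p$2)\<^sup>2 \<le> 5 * \<bar>p$2\<bar>"
    using mult_right_mono[OF p2, of "\<bar>p$2\<bar>"] by (simp add: power2_eq_square)
  ultimately show False by simp
qed

lemma slide_configuration:
  assumes "s = 1 \<or> s = -1"
  shows "restrict (slide s) (\<Union>facets) \<in> Delaunay_configurations realization hexagon (\<lambda>x. x)"
proof -
  have s: "\<bar>s\<bar> \<le> 1" using assms by auto
  have "\<forall>v\<in>boundary_vertices realization. slide s v = v"
    by (auto simp: boundary_vertices_facets Union_facets slide_vertex)
  then show ?thesis
    unfolding Delaunay_configurations_def vertices_realization
    by (intro CollectI exI[of _ "slide s"] conjI refl polygon_triangulation_slide[OF s]
        strictly_Delaunay_slide[OF assms] isotopic_slide[OF s])
qed

text \<open>The first coordinate of the image of the interior vertex is a continuous function that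
  takes the values 1 and -1 but never 0.\<close>

lemma not_connected_Delaunay_space: "\<not> connected_space (Delaunay_space realization hexagon (\<lambda>x. x))"
proof
  let ?X = "Delaunay_space realization hexagon (\<lambda>x. x)"
  let ?f = "\<lambda>g. g (pt 0 0) $ 1 :: real"
  assume "connected_space ?X"
  then have conn: "connectedin ?X (topspace ?X)" by (simp add: connectedin_topspace)
  \<comment> \<open>Configurations are restrictions to the vertex set, hence extensional, so all of
    them are points of the product.\<close>
  have X: "topspace ?X = Delaunay_configurations realization hexagon (\<lambda>x. x)"
    unfolding Delaunay_space_def by (auto simp: Delaunay_configurations_def)
  have "continuous_map (product_topology (\<lambda>_. euclidean) (complex_vertices realization)) (euclidean :: (real^2) topology)
      (\<lambda>g. g (pt 0 0))"
    by (rule continuous_map_product_projection) (simp add: vertices_realization Union_facets)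
  then have "continuous_map ?X euclidean (\<lambda>g. g (pt 0 0))"
    unfolding Delaunay_space_def by (rule continuous_map_from_subtopology)
  moreover have "continuous_map euclidean euclideanreal (\<lambda>v::real^2. v $ 1)"
    by (simp add: continuous_map_iff_continuous2 continuous_on_component)
  ultimately have "continuous_map ?X euclideanreal ?f"
    using continuous_map_compose unfolding o_def by fast
  from connectedin_continuous_map_image[OF this conn]
  have conn': "connected (?f ` topspace ?X)" by simp
  have "s \<in> ?f ` topspace ?X" if "s = 1 \<or> s = -1" for s
    unfolding X using slide_configuration[OF that]
    by (rule rev_image_eqI) (simp add: slide_vertex Union_facets)
  then have "{-1..1} \<subseteq> ?f ` topspace ?X"
    by (intro connected_contains_Icc[OF conn']) auto
  then have "0 \<in> ?f ` topspace ?X" by (rule subsetD) simp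
  then show False unfolding X using configuration_avoids_axis by force
qed

theorem mainTheorem4:
  shows "\<exists>(P::(real^2) set) (T::(real^2) set set) (\<psi>::real^2 \<Rightarrow> real^2).
    convex_polygon P \<and> disk_complex T \<and> polygon_triangulation T P \<psi> \<and>
    \<not> connected_space (Delaunay_space T P \<psi>)"
  \<comment> \<open>The reference triangulation is the identity, treated as
    \<open>slide 0\<close>.\<close>
  using convex_polygon_hexagon disk_complex_realization polygon_triangulation_slide[of 0]
    not_connected_Delaunay_space unfolding slide_0 by auto

end
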